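(* The following identities hold in the field $\mathbb{C}((z^{-1}))$: \begin{align*} A_{0,0}(z) & =\frac{1}{z-a_{0}^{(0)}-\sum_{i=1}^{q}\sum_{j=1}^{p}a_{0}^{(i)}a_{0}^{(-j)}\,A_{i-1,j-1}^{(1)}(z)},\\ A_{0,j}(z) & =A_{0,0}(z)\sum_{i=1}^{q} a_{0}^{(i)}A_{i-1,j-1}^{(1)}(z), \qquad j\geq 1,\\ A_{i,0}(z) & =A_{0,0}(z)\sum_{j=1}^{p} a_{0}^{(-j)}A_{i-1,j-1}^{(1)}(z), \qquad i\geq 1,\\ A_{i,j}(z) & =\frac{A_{i,0}(z)\,A_{0,j}(z)}{A_{0,0}(z)}+A^{(1)}_{i-1,j-1}(z), \qquad i, j\geq 1. \end{align*}
   Context: Fix integers $p,q\geq 1$ and, for each $-p\leq k\leq q$, a bi-infinite sequence $(a^{(k)}_{n})_{n\in\mathbb{Z}}$ of complex numbers. A step is an ordered pair $(n,m)\rightarrow(n+1,m')$ with $n\in\mathbb{Z}_{\geq 0}$, $m,m'\in\mathbb{Z}$ and $-p\leq m'-m\leq q$. Its weight is $a_m^{(i)}$ if $m'=m+i$ with $0\leq i\leq q$, and $a_{m-j}^{(-j)}$ if $m'=m-j$ with $1\leq j\leq p$. A lattice path of length $k$ is a sequence of $k$ steps in which the final vertex of each step is the initial vertex of the next; a path of length zero is a single vertex. The weight $w(\gamma)$ of a path $\gamma$ is the product of the weights of its steps (and $1$ for paths of length zero). Empty sums are zero. For $n,i,j\geq 0$: $\mathcal{D}_{[n,i,j]}$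 is the collection of all lattice paths of length $n$ with initial point $(0,i)$ and final point $(n,j)$ having no point below the $x$-axis; $\mathcal{D}^{(1)}_{[n,i,j]}$ is the subcollection of $\mathcal{D}_{[n,i+1,j+1]}$ of those paths with no point below the line $y=1$. Put $$A_{[n,i,j]}=\sum_{\gamma\in\mathcal{D}_{[n,i,j]}}w(\gamma),\qquad A^{(1)}_{[n,i,j]}=\sum_{\gamma\in\mathcal{D}^{(1)}_{[n,i,j]}}w(\gamma),$$ $$A_{i,j}(z)=\sum_{n=0}^{\infty}\frac{A_{[n,i,j]}}{z^{n+1}},\qquad A^{(1)}_{i,j}(z)=\sum_{n=0}^{\infty}\frac{A^{(1)}_{[n,i,j]}}{z^{n+1}}.$$ $\mathbb{C}((z^{-1}))$ is the field of formal series $\sum_{n\in\mathbb{Z}}a_nz^n$ with complex coefficients and only finitely many nonzero $a_n$ with $n>0$. *)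

theory Defs
  imports "HOL-Computational_Algebra.Formal_Laurent_Series"
begin

type_synonym vertex = "nat \<times> int"

definition is_step :: "nat \<Rightarrow> nat \<Rightarrow> vertex \<Rightarrow> vertex \<Rightarrow> bool" where
  "is_step p q u v \<longleftrightarrow>
     fst v = fst u + 1 \<and> - int p \<le> snd v - snd u \<and> snd v - snd u \<le> int q"

text \<open>
  The weight family is \<open>a k n\<close>, standing for \<open>a\<^sup>(\<^sup>k\<^sup>)\<^sub>n\<close>; only the values with
  \<open>- p \<le> k \<le> q\<close> matter. An up or level step is indexed by the height of its initial vertex,
  a down step by the height of its final vertex.
\<close>

definition step_weight :: "(int \<Rightarrow> int \<Rightarrow> complex) \<Rightarrow> vertex \<Rightarrow> vertex \<Rightarrow> complex" where
  "step_weight a u v =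
     (if snd u \<le> snd v then a (snd v - snd u) (snd u) else a (snd v - snd u) (snd v))"

text \<open>
  A path is encoded by the nonempty list of its vertices, so a path of length \<open>k\<close> has
  \<open>k + 1\<close> entries and a path of length zero is a singleton list.
\<close>

definition lattice_path :: "nat \<Rightarrow> nat \<Rightarrow> vertex list \<Rightarrow> bool" where
  "lattice_path p q \<gamma> \<longleftrightarrow> \<gamma> \<noteq> [] \<and> successively (is_step p q) \<gamma>"

definition path_length :: "vertex list \<Rightarrow> nat" where
  "path_length \<gamma> = length \<gamma> - 1"

definition path_weight :: "(int \<Rightarrow> int \<Rightarrow> complex) \<Rightarrow> vertex list \<Rightarrow> complex" where
  "path_weight a \<gamma> = (\<Prod>(u, v)\<leftarrow>zip \<gamma> (tl \<gamma>). step_weight a u v)"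

definition paths :: "nat \<Rightarrow> nat \<Rightarrow> nat \<Rightarrow> nat \<Rightarrow> nat \<Rightarrow> vertex list set" where
  "paths p q n i j =
     {\<gamma>. lattice_path p q \<gamma> \<and> path_length \<gamma> = n \<and> hd \<gamma> = (0, int i) \<and> last \<gamma> = (n, int j)
        \<and> (\<forall>v\<in>set \<gamma>. 0 \<le> snd v)}"

definition paths1 :: "nat \<Rightarrow> nat \<Rightarrow> nat \<Rightarrow> nat \<Rightarrow> nat \<Rightarrow> vertex list set" where
  "paths1 p q n i j = {\<gamma> \<in> paths p q n (i + 1) (j + 1). \<forall>v\<in>set \<gamma>. 1 \<le> snd v}"

definition A_coeff ::
  "nat \<Rightarrow> nat \<Rightarrow> (int \<Rightarrow> int \<Rightarrow> complex) \<Rightarrow> nat \<Rightarrow> nat \<Rightarrow> nat \<Rightarrow> complex" where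
  "A_coeff p q a n i j = (\<Sum>\<gamma>\<in>paths p q n i j. path_weight a \<gamma>)"

definition A1_coeff ::
  "nat \<Rightarrow> nat \<Rightarrow> (int \<Rightarrow> int \<Rightarrow> complex) \<Rightarrow> nat \<Rightarrow> nat \<Rightarrow> nat \<Rightarrow> complex" where
  "A1_coeff p q a n i j = (\<Sum>\<gamma>\<in>paths1 p q n i j. path_weight a \<gamma>)"

text \<open>
  The field \<open>\<complex>((z\<^sup>-\<^sup>1))\<close> is the type \<^typ>\<open>complex fls\<close> of formal Laurent series whose
  variable \<^const>\<open>fls_X\<close> is read as \<open>z\<^sup>-\<^sup>1\<close>: the coefficient of \<open>z\<^sup>n\<close> is
  \<open>fls_nth f (- n)\<close>, and \<open>z\<close> itself is \<^const>\<open>fls_X_inv\<close>.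
\<close>

abbreviation zvar :: "complex fls" where
  "zvar \<equiv> fls_X_inv"

text \<open>The formal series \<open>\<Sum>n\<ge>0. c n / z^(n + 1)\<close>.\<close>

definition z_series :: "(nat \<Rightarrow> complex) \<Rightarrow> complex fls" where
  "z_series c = fps_to_fls (Abs_fps c) / zvar"

definition A_series ::
  "nat \<Rightarrow> nat \<Rightarrow> (int \<Rightarrow> int \<Rightarrow> complex) \<Rightarrow> nat \<Rightarrow> nat \<Rightarrow> complex fls" where
  "A_series p q a i j = z_series (\<lambda>n. A_coeff p q a n i j)"

definition A1_series ::
  "nat \<Rightarrow> nat \<Rightarrow> (int \<Rightarrow> int \<Rightarrow> complex) \<Rightarrow> nat \<Rightarrow> nat \<Rightarrow> complex fls" where
  "A1_series p q a i j = z_series (\<lambda>n. A1_coeff p q a n i j)"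

lemma z_series_nth:
  "fls_nth (z_series c) k = (if 1 \<le> k then c (nat (k - 1)) else 0)"
proof -
  have "z_series c = fls_shift (-1) (fps_to_fls (Abs_fps c))"
    unfolding z_series_def
    by (simp add: divide_inverse fls_inverse_X_inv fls_X_times_conv_shift)
  then show ?thesis by auto
qed

text \<open>The sums over paths are finite sums.\<close>

lemma finite_paths: "finite (paths p q n i j)"
proof -
  let ?V = "{0..n} \<times> {0..int i + int n * int q}"
  have "paths p q n i j \<subseteq> {\<gamma>. set \<gamma> \<subseteq> ?V \<and> length \<gamma> = n + 1}"
  proof safe
    fix \<gamma> assume g: "\<gamma> \<in> paths p q n i j"
    then have ne: "\<gamma> \<noteq> []" and st: "successively (is_step p q) \<gamma>" and h: "hd \<gamma> = (0, int i)"
      and len: "length \<gamma> = n + 1" and nn: "\<forall>v\<in>set \<gamma>. 0 \<le> snd v"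
      by (auto simp: paths_def lattice_path_def path_length_def simp flip: length_greater_0_conv)
    show "length \<gamma> = n + 1" by (fact len)
    have b: "fst (\<gamma> ! k) = k \<and> snd (\<gamma> ! k) \<le> int i + int k * int q" if "k < length \<gamma>" for k
      using that
    proof (induction k)
      case 0
      then show ?case using h ne by (simp add: hd_conv_nth)
    next
      case (Suc k)
      then have "is_step p q (\<gamma> ! k) (\<gamma> ! Suc k)"
        using st by (simp add: successively_conv_nth)
      then show ?case using Suc by (auto simp: is_step_def algebra_simps)
    qed
    fix x y assume "(x, y) \<in> set \<gamma>"
    then obtain k where k: "k < length \<gamma>" "\<gamma> ! k = (x, y)" by (auto simp: in_set_conv_nth)
    have "int k * int q \<le> int n * int q" using k len by (intro mult_right_mono) auto
    with b[OF k(1)] k len nn \<open>(x, y) \<in> set \<gamma>\<close>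
    show "x \<in> {0..n}" "y \<in> {0..int i + int n * int q}" by force+
  qed
  moreover have "finite {\<gamma>. set \<gamma> \<subseteq> ?V \<and> length \<gamma> = n + 1}"
    by (rule finite_lists_length_eq) simp
  ultimately show ?thesis by (rule finite_subset)
qed

end

theory Submission
  imports Defs
begin

text \<open>
  Splitting off the first step gives linear equations \<open>z A\<^sub>i\<^sub>j = \<delta>\<^sub>i\<^sub>j + \<Sum>\<^sub>m w\<^sub>i\<^sub>m A\<^sub>m\<^sub>j\<close>, and the same
  equations restricted to indices at least 1 for the paths above the line \<open>y = 1\<close>. Such a system
  has at most one solution in series without polynomial part. Hence, for \<open>i \<ge> 1\<close>,
  \<open>A\<^sub>i\<^sub>j = A\<^sup>(\<^sup>1\<^sup>)\<^sub>i\<^sub>-\<^sub>1\<^sub>,\<^sub>j\<^sub>-\<^sub>1 + U\<^sub>i A\<^sub>0\<^sub>j\<close> where \<open>U\<^sub>i = \<Sum>\<^sub>k w\<^sub>k\<^sub>0 A\<^sup>(\<^sup>1\<^sup>)\<^sub>i\<^sub>-\<^sub>1\<^sub>,\<^sub>k\<^sub>-\<^sub>1\<close> (the first visit to the axis),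
  a term with \<open>j - 1 = -1\<close> being 0, because the right-hand side solves the same equations. Substituting this into the equation for
  \<open>i = 0\<close> and solving for \<open>A\<^sub>0\<^sub>j\<close> yields all four identities.
\<close>

section \<open>Paths above a horizontal floor\<close>

text \<open>The floor \<open>h\<close> lets one recursion serve both families: \<open>h = 0\<close>
  and \<open>h = 1\<close> give the two kinds of paths in the theorem. Heights stay absolute, so
  both kinds carry the same weights and only the indices of \<open>A1_series\<close> are
  shifted.\<close>

definition floor_paths ::
  "nat \<Rightarrow> nat \<Rightarrow> nat \<Rightarrow> nat \<Rightarrow> nat \<Rightarrow> nat \<Rightarrow> vertex list set" where
  "floor_paths p q h n i j = {\<gamma> \<in> paths p q n i j. \<forall>v\<in>set \<gamma>. int h \<le> snd v}"

definition floor_coeff ::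
  "nat \<Rightarrow> nat \<Rightarrow> (int \<Rightarrow> int \<Rightarrow> complex) \<Rightarrow> nat \<Rightarrow> nat \<Rightarrow> nat \<Rightarrow> nat \<Rightarrow> complex" where
  "floor_coeff p q a h n i j = (\<Sum>\<gamma>\<in>floor_paths p q h n i j. path_weight a \<gamma>)"

definition floor_series ::
  "nat \<Rightarrow> nat \<Rightarrow> (int \<Rightarrow> int \<Rightarrow> complex) \<Rightarrow> nat \<Rightarrow> nat \<Rightarrow> nat \<Rightarrow> complex fls" where
  "floor_series p q a h i j = z_series (\<lambda>n. floor_coeff p q a h n i j)"

text \<open>The transfer matrix of a single step. Extension by zero outside the band lets sums over
  \<open>m\<close> run over convenient intervals; the abscissas 0 and 1 are immaterial, since
  \<open>step_weight\<close> sees only heights.\<close>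

definition height_weight ::
  "nat \<Rightarrow> nat \<Rightarrow> (int \<Rightarrow> int \<Rightarrow> complex) \<Rightarrow> nat \<Rightarrow> nat \<Rightarrow> complex" where
  "height_weight p q a i m =
     (if i \<le> m + p \<and> m \<le> i + q then step_weight a (0, int i) (1, int m) else 0)"

lemma A_series_eq_floor_series: "A_series p q a i j = floor_series p q a 0 i j"
proof -
  have "floor_paths p q 0 n i j = paths p q n i j" for n
    by (auto simp: floor_paths_def paths_def)
  then show ?thesis by (simp add: A_series_def floor_series_def A_coeff_def floor_coeff_def)
qed

lemma A1_series_eq_floor_series: "A1_series p q a i j = floor_series p q a 1 (i + 1) (j + 1)"
proof -
  have "floor_paths p q 1 n (i + 1) (j + 1) = paths1 p q n i j" for n
    by (simp add: floor_paths_def paths1_def)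
  then show ?thesis by (simp add: A1_series_def floor_series_def A1_coeff_def floor_coeff_def)
qed

lemma finite_floor_paths: "finite (floor_paths p q h n i j)"
  unfolding floor_paths_def by (intro finite_subset[OF _ finite_paths[of p q n i j]]) auto

text \<open>The final vertex itself would violate the floor. This makes the terms with final index 0
  vanish for \<open>h = 1\<close>.\<close>

lemma floor_paths_below_floor:
  assumes "j < h"
  shows "floor_paths p q h n i j = {}"
proof (intro equals0I)
  fix \<gamma> assume g: "\<gamma> \<in> floor_paths p q h n i j"
  then have "\<gamma> \<noteq> []" and l: "last \<gamma> = (n, int j)"
    by (simp_all add: floor_paths_def paths_def lattice_path_def)
  then have "(n, int j) \<in> set \<gamma>" by (metis last_in_set)
  with g assms show False by (force simp: floor_paths_def)
qed

lemma floor_series_below_floor: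
  assumes "j < h"
  shows "floor_series p q a h i j = 0"
  by (rule fls_eqI) (simp add: floor_series_def floor_coeff_def z_series_nth
        floor_paths_below_floor[OF assms])

section \<open>Splitting off the first step\<close>

text \<open>Abscissas increase along a path. Hence all vertices after the first step have abscissa
  at least 1 and can be shifted left.\<close>

lemma fst_hd_le:
  assumes "successively (is_step p q) \<gamma>" "v \<in> set \<gamma>"
  shows "fst (hd \<gamma>) \<le> fst v"
  using assms
proof (induction \<gamma>)
  case (Cons u \<gamma>)
  then show ?case by (cases \<gamma>) (auto simp: is_step_def)
qed simp

lemma floor_paths_0:
  assumes "h \<le> i"
  shows "floor_paths p q h 0 i j = (if i = j then {[(0, int i)]} else {})"
proof -
  have "\<gamma> \<in> floor_paths p q h 0 i j \<longleftrightarrow> i = j \<and> \<gamma> = [(0, int i)]" for \<gamma>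
    using assms
    by (cases \<gamma>) (auto simp: floor_paths_def paths_def lattice_path_def path_length_def)
  then show ?thesis by auto
qed

text \<open>Every path starts at abscissa 0, so the remainder is translated right by one to make
  room for the new first vertex.\<close>

definition prepend :: "nat \<Rightarrow> vertex list \<Rightarrow> vertex list" where
  "prepend i \<gamma> = (0, int i) # map (apfst Suc) \<gamma>"

lemma is_step_apfst_Suc [simp]: "is_step p q (apfst Suc u) (apfst Suc v) = is_step p q u v"
  by (simp add: is_step_def)

lemma step_weight_apfst_Suc [simp]: "step_weight a (apfst Suc u) (apfst Suc v) = step_weight a u v"
  by (simp add: step_weight_def)

text \<open>The inverse deletes the first vertex and translates the rest left by one;
  \<open>m\<close> is the height reached by the first step. The assumption \<open>h \<le> i\<close>
  keeps the prepended vertex on or above the floor.\<close>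

lemma bij_betw_prepend:
  fixes p q h i :: nat
  assumes "h \<le> i"
  defines "M \<equiv> {m. h \<le> m \<and> i \<le> m + p \<and> m \<le> i + q}"
  shows "bij_betw (\<lambda>(m, \<gamma>). prepend i \<gamma>) (SIGMA m:M. floor_paths p q h n m j)
           (floor_paths p q h (Suc n) i j)"
  unfolding bij_betw_def
proof (intro conjI set_eqI iffI)
  have inj: "inj (map (apfst Suc :: vertex \<Rightarrow> vertex))"
    by (intro inj_mapI injI) (auto simp: prod_eq_iff)
  \<comment> \<open>The index \<open>m\<close> can be read off from the first vertex of the
    remainder.\<close>
  have "m = m'" if "\<gamma> \<in> floor_paths p q h n m j" "\<gamma> \<in> floor_paths p q h n m' j" for m m' \<gamma>
    using that by (auto simp: floor_paths_def paths_def)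
  then show "inj_on (\<lambda>(m, \<gamma>). prepend i \<gamma>) (SIGMA m:M. floor_paths p q h n m j)"
    by (auto simp: inj_on_def prepend_def dest: injD[OF inj])
next
  fix \<gamma> assume "\<gamma> \<in> (\<lambda>(m, \<gamma>). prepend i \<gamma>) ` (SIGMA m:M. floor_paths p q h n m j)"
  then obtain m \<delta> where g: "\<gamma> = prepend i \<delta>" and m: "m \<in> M" and d: "\<delta> \<in> floor_paths p q h n m j"
    by auto
  from d obtain \<delta>' where "\<delta> = (0, int m) # \<delta>'"
    by (cases \<delta>) (auto simp: floor_paths_def paths_def lattice_path_def)
  with d m assms(1) show "\<gamma> \<in> floor_paths p q h (Suc n) i j"
    by (auto simp: g prepend_def floor_paths_def paths_def lattice_path_def path_length_def
        successively_map M_def is_step_def successively_Cons last_map hd_map split: if_splits)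
next
  fix \<gamma> assume g: "\<gamma> \<in> floor_paths p q h (Suc n) i j"
  then obtain v \<delta> where gv: "\<gamma> = (0, int i) # v # \<delta>"
    by (cases \<gamma>; cases "tl \<gamma>")
       (auto simp: floor_paths_def paths_def lattice_path_def path_length_def)
  have st: "is_step p q (0, int i) v" and succ: "successively (is_step p q) (v # \<delta>)"
    using g by (auto simp: gv floor_paths_def paths_def lattice_path_def)
  have h: "int h \<le> snd v" using g by (auto simp: gv floor_paths_def)
  define m where "m = nat (snd v)"
  have v: "v = (1, int m)" using st h by (auto simp: m_def is_step_def prod_eq_iff)
  define \<epsilon> where "\<epsilon> = map (apfst (\<lambda>t. t - 1)) (v # \<delta>)"
  \<comment> \<open>The truncated subtraction is undone by \<open>Suc\<close> because no abscissa
    here is 0.\<close>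
  have "map (apfst Suc \<circ> apfst (\<lambda>t. t - 1)) (v # \<delta>) = v # \<delta>"
    using fst_hd_le[OF succ] by (intro map_idI) (force simp: v prod_eq_iff)
  then have e: "map (apfst Suc) \<epsilon> = v # \<delta>" by (simp add: \<epsilon>_def)
  have ne: "\<epsilon> \<noteq> []" by (simp add: \<epsilon>_def)
  have "successively (is_step p q) (map (apfst Suc) \<epsilon>)" using succ e by simp
  then have "successively (is_step p q) \<epsilon>" by (simp add: successively_map)
  moreover have "length \<epsilon> = n + 1"
    using g by (auto simp: gv \<epsilon>_def floor_paths_def paths_def path_length_def)
  moreover have "hd \<epsilon> = (0, int m)" by (simp add: \<epsilon>_def v)
  moreover have "last \<epsilon> = (n, int j)"
  proof -
    have "apfst Suc (last \<epsilon>) = last (v # \<delta>)" by (simp only: last_map[OF ne, symmetric] e)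
    also have "\<dots> = (Suc n, int j)" using g by (simp add: gv floor_paths_def paths_def)
    finally show ?thesis by (simp add: prod_eq_iff)
  qed
  moreover have "int h \<le> snd u" if "u \<in> set \<epsilon>" for u
  proof -
    have "snd ` set \<epsilon> = snd ` set (v # \<delta>)" by (force simp: \<epsilon>_def)
    with that have "snd u \<in> snd ` set (v # \<delta>)" by blast
    with g show ?thesis by (auto simp: gv floor_paths_def)
  qed
  ultimately have "\<epsilon> \<in> floor_paths p q h n m j"
    using ne by (force simp: floor_paths_def paths_def lattice_path_def path_length_def)
  moreover have "m \<in> M" using st h by (auto simp: M_def v is_step_def)
  moreover have "\<gamma> = prepend i \<epsilon>" by (simp add: prepend_def e gv)
  ultimately show "\<gamma> \<in> (\<lambda>(m, \<gamma>). prepend i \<gamma>) ` (SIGMA m:M. floor_paths p q h n m j)"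
    by force
qed

lemma path_weight_prepend:
  assumes "\<gamma> \<noteq> []"
  shows "path_weight a (prepend i \<gamma>) = step_weight a (0, int i) (hd \<gamma>) * path_weight a \<gamma>"
proof -
  have "path_weight a (map (apfst Suc) \<gamma>) = path_weight a \<gamma>"
    by (simp add: path_weight_def map_tl[symmetric] zip_map_map split_def comp_def)
  then show ?thesis using assms
    by (cases \<gamma>) (auto simp: prepend_def path_weight_def step_weight_def)
qed

lemma floor_coeff_0:
  assumes "h \<le> i"
  shows "floor_coeff p q a h 0 i j = (if i = j then 1 else 0)"
  by (simp add: floor_coeff_def floor_paths_0[OF assms] path_weight_def)

lemma floor_coeff_Suc:
  assumes "h \<le> i"
  shows "floor_coeff p q a h (Suc n) i j
    = (\<Sum>m=h..i+q. height_weight p q a i m * floor_coeff p q a h n m j)"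
proof -
  define M where "M = {m. h \<le> m \<and> i \<le> m + p \<and> m \<le> i + q}"
  have fin: "finite M" unfolding M_def by (rule finite_subset[of _ "{..i+q}"]) auto
  \<comment> \<open>The head of \<gamma> is \<open>(0, int m)\<close>, not
    \<open>(1, int m)\<close>, which leaves the step weight unchanged.\<close>
  have wt: "path_weight a (prepend i \<gamma>) = height_weight p q a i m * path_weight a \<gamma>"
    if "m \<in> M" "\<gamma> \<in> floor_paths p q h n m j" for m \<gamma>
    using that path_weight_prepend[of \<gamma> a i]
    by (auto simp: floor_paths_def paths_def lattice_path_def height_weight_def M_def
        step_weight_def)
  have "floor_coeff p q a h (Suc n) i j
      = (\<Sum>(m, \<gamma>)\<in>(SIGMA m:M. floor_paths p q h n m j). path_weight a (prepend i \<gamma>))"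
    unfolding floor_coeff_def
    using sum.reindex_bij_betw[OF bij_betw_prepend[OF assms, of p q n j], of "path_weight a"]
    by (simp add: M_def split_def)
  also have "\<dots> = (\<Sum>m\<in>M. \<Sum>\<gamma>\<in>floor_paths p q h n m j. path_weight a (prepend i \<gamma>))"
    by (rule sum.Sigma[symmetric]) (use fin finite_floor_paths in auto)
  also have "\<dots> = (\<Sum>m\<in>M. height_weight p q a i m * floor_coeff p q a h n m j)"
    by (simp add: floor_coeff_def sum_distrib_left wt)
  \<comment> \<open>The added indices lie more than \<open>p\<close> below \<open>i\<close>, where
    \<open>height_weight\<close> is 0.\<close>
  also have "\<dots> = (\<Sum>m=h..i+q. height_weight p q a i m * floor_coeff p q a h n m j)"
    by (rule sum.mono_neutral_left) (auto simp: M_def height_weight_def)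
  finally show ?thesis .
qed

section \<open>Linear equations for the series\<close>

text \<open>Multiplication by z lowers every exponent of 1/z by one, so the term for
  \<open>n = 0\<close> becomes the constant term.\<close>

lemma fls_X_inv_times_z_series:
  "zvar * z_series c = fls_const (c 0) + z_series (\<lambda>n. c (Suc n))"
  by (rule fls_eqI)
     (auto simp: fls_X_inv_times_conv_shift z_series_nth Suc_nat_eq_nat_zadd1)

lemma z_series_lincomb:
  "z_series (\<lambda>n. \<Sum>m\<in>S. w m * c m n) = (\<Sum>m\<in>S. fls_const (w m) * z_series (c m))"
  by (rule fls_eqI) (simp add: fls_nth_sum z_series_nth)

lemma floor_series_first_step:
  assumes "h \<le> i"
  shows "zvar * floor_series p q a h i j = (if i = j then 1 else 0)
    + (\<Sum>m=h..i+q. fls_const (height_weight p q a i m) * floor_series p q a h m j)"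
  by (simp add: floor_series_def fls_X_inv_times_z_series floor_coeff_0[OF assms]
      floor_coeff_Suc[OF assms] z_series_lincomb)

section \<open>Uniqueness of solutions without polynomial part\<close>

text \<open>The equation expresses the coefficient at \<open>k + 1\<close> of \<open>D i\<close>
  through the coefficients at \<open>k\<close> of finitely many \<open>D m\<close>. Induction on
  \<open>k\<close>, for all \<open>i\<close> simultaneously, starts from the vanishing coefficient
  at 0.\<close>

lemma homogeneous_solution_eq_0:
  fixes D :: "nat \<Rightarrow> complex fls"
  assumes eq: "\<And>i. i \<ge> h \<Longrightarrow> zvar * D i = (\<Sum>m=h..i+q. fls_const (w i m) * D m)"
    and neg: "\<And>i k. i \<ge> h \<Longrightarrow> k \<le> 0 \<Longrightarrow> fls_nth (D i) k = 0"
    and "i \<ge> h"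
  shows "D i = 0"
proof -
  have "fls_nth (D i) (int k) = 0" if "i \<ge> h" for i k
    using that
  proof (induction k arbitrary: i)
    case 0
    then show ?case using neg[of i 0] by simp
  next
    case (Suc k)
    have "fls_nth (D i) (int (Suc k)) = fls_nth (zvar * D i) (int k)"
      by (simp add: fls_X_inv_times_conv_shift add.commute)
    also have "\<dots> = 0" using Suc by (simp add: eq fls_nth_sum)
    finally show ?case .
  qed
  then have "fls_nth (D i) k = 0" for k
    using neg[of i k] \<open>i \<ge> h\<close> by (cases "k \<le> 0") (auto simp: not_le dest!: zero_less_imp_eq_int)
  then show ?thesis by (intro fls_eqI) simp
qed

text \<open>The zero series is a separate case because its subdegree is 0 by convention.\<close>

lemma z_series_subdegree: "z_series c = 0 \<or> fls_subdegree (z_series c) \<ge> 1"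
  by (cases "z_series c = 0") (auto intro!: fls_subdegree_geI simp: z_series_nth)

lemma z_series_times_nth_nonpos:
  assumes "k \<le> 0"
  shows "fls_nth (z_series c * z_series d) k = 0"
proof (cases "z_series c = 0 \<or> z_series d = 0")
  case False
  with z_series_subdegree[of c] z_series_subdegree[of d] assms show ?thesis
    by (intro fls_times_nth_eq0) linarith
qed auto

section \<open>Decomposition at the first visit to the axis\<close>

text \<open>The sum over \<open>k\<close> counts the paths from height \<open>i\<close> that touch
  the axis only at their end: a path above the axis to height \<open>k\<close>, then a down step. No
  bijection is built; the difference \<open>D\<close> of the two sides solves the homogeneous system
  with floor 1.\<close>

lemma floor_series_first_visit:
  assumes "i \<ge> 1"
  shows "floor_series p q a 0 i j = floor_series p q a 1 i j
    + (\<Sum>k=1..p. fls_const (height_weight p q a k 0) * floor_series p q a 1 i k)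
      * floor_series p q a 0 0 j"
proof -
  let ?F = "floor_series p q a" and ?w = "\<lambda>i m. fls_const (height_weight p q a i m)"
  define U where "U i = (\<Sum>k=1..p. ?w k 0 * ?F 1 i k)" for i
  define D where "D i = ?F 0 i j - ?F 1 i j - U i * ?F 0 0 j" for i
  have zU: "zvar * U i = ?w i 0 + (\<Sum>m=1..i+q. ?w i m * U m)" if "i \<ge> 1" for i
  proof -
    have "zvar * U i = (\<Sum>k=1..p. ?w k 0 * (zvar * ?F 1 i k))"
      by (simp add: U_def sum_distrib_left mult_ac)
    also have "\<dots> = (\<Sum>k=1..p. ?w k 0 * (if i = k then 1 else 0))
        + (\<Sum>k=1..p. \<Sum>m=1..i+q. ?w k 0 * (?w i m * ?F 1 m k))"
      using that by (simp add: floor_series_first_step distrib_left sum.distrib sum_distrib_left)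
    \<comment> \<open>For \<open>i > p\<close> both sides are 0, since no single step leads from
      \<open>i\<close> to the axis.\<close>
    also have "(\<Sum>k=1..p. ?w k 0 * (if i = k then 1 else 0)) = ?w i 0"
      using that by (auto simp: height_weight_def if_distrib sum.delta cong: if_cong)
    also have "(\<Sum>k=1..p. \<Sum>m=1..i+q. ?w k 0 * (?w i m * ?F 1 m k)) = (\<Sum>m=1..i+q. ?w i m * U m)"
      by (subst sum.swap) (simp add: U_def sum_distrib_left mult_ac)
    finally show ?thesis .
  qed
  have "D i = 0"
  proof (rule homogeneous_solution_eq_0[where D = D and w = "height_weight p q a" and q = q])
    fix i :: nat assume i: "i \<ge> 1"
    \<comment> \<open>The term for \<open>m = 0\<close> is isolated because it cancels against the
      inhomogeneous term \<open>?w i 0\<close> of \<open>zU\<close> times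
      \<open>?F 0 0 j\<close>.\<close>
    have "zvar * ?F 0 i j = (if i = j then 1 else 0)
        + (?w i 0 * ?F 0 0 j + (\<Sum>m=1..i+q. ?w i m * ?F 0 m j))"
      by (simp add: floor_series_first_step sum.atLeast_Suc_atMost[of 0])
    then show "zvar * D i = (\<Sum>m=1..i+q. ?w i m * D m)"
      using i by (simp add: D_def right_diff_distrib mult.assoc[symmetric] zU floor_series_first_step
          sum_subtractf distrib_right sum_distrib_right)
  next
    fix i :: nat and k :: int assume "k \<le> 0"
    then show "fls_nth (D i) k = 0"
      by (simp add: D_def U_def sum_distrib_right fls_nth_sum mult.assoc)
         (simp add: floor_series_def z_series_nth z_series_times_nth_nonpos)
  qed (use assms in auto)
  then show ?thesis by (simp add: D_def U_def algebra_simps)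
qed

section \<open>Solving the equation at height 0\<close>

theorem theorem2p1:
  fixes p q :: nat and a :: "int \<Rightarrow> int \<Rightarrow> complex"
  assumes "p \<ge> 1" and "q \<ge> 1"
  shows
    "A_series p q a 0 0 =
       1 / (zvar - fls_const (a 0 0)
            - (\<Sum>i=1..q. \<Sum>j=1..p.
                 fls_const (a (int i) 0) * fls_const (a (- int j) 0)
                 * A1_series p q a (i - 1) (j - 1)))
     \<and> (\<forall>j\<ge>1. A_series p q a 0 j =
          A_series p q a 0 0
          * (\<Sum>i=1..q. fls_const (a (int i) 0) * A1_series p q a (i - 1) (j - 1)))
     \<and> (\<forall>i\<ge>1. A_series p q a i 0 =
          A_series p q a 0 0
          * (\<Sum>j=1..p. fls_const (a (- int j) 0) * A1_series p q a (i - 1) (j - 1)))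
     \<and> (\<forall>i\<ge>1. \<forall>j\<ge>1. A_series p q a i j =
          A_series p q a i 0 * A_series p q a 0 j / A_series p q a 0 0
          + A1_series p q a (i - 1) (j - 1))"
proof -
  let ?F = "floor_series p q a" and ?w = "\<lambda>i m. fls_const (height_weight p q a i m)"
  define U where "U i = (\<Sum>k=1..p. ?w k 0 * ?F 1 i k)" for i
  \<comment> \<open>Counterpart of \<open>U\<close> for departures: the paths from the axis to
    height \<open>j\<close> that never return to it.\<close>
  define V where "V j = (\<Sum>i=1..q. ?w 0 i * ?F 1 i j)" for j
  define K where "K = zvar - fls_const (a 0 0) - (\<Sum>i=1..q. ?w 0 i * U i)"
  have visit: "?F 0 i j = ?F 1 i j + U i * ?F 0 0 j" if "i \<ge> 1" for i j
    using floor_series_first_visit[OF that] by (simp add: U_def)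
  \<comment> \<open>Substituting \<open>visit\<close> into the first-step equation at height 0
    leaves \<open>?F 0 0 j\<close> as the only unknown, with coefficient \<open>K\<close>.\<close>
  have K: "K * ?F 0 0 j = (if j = 0 then 1 else 0) + V j" for j
  proof -
    have "zvar * ?F 0 0 j = (if j = 0 then 1 else 0) + ?w 0 0 * ?F 0 0 j
        + (\<Sum>m=1..q. ?w 0 m * ?F 0 m j)"
      by (simp add: floor_series_first_step sum.atLeast_Suc_atMost[of 0])
    also have "?w 0 0 = fls_const (a 0 0)" by (simp add: height_weight_def step_weight_def)
    also have "(\<Sum>m=1..q. ?w 0 m * ?F 0 m j) = V j + (\<Sum>m=1..q. ?w 0 m * U m) * ?F 0 0 j"
      by (simp add: visit V_def sum_distrib_right distrib_left sum.distrib mult.assoc)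
    finally show ?thesis by (simp add: K_def algebra_simps)
  qed
  have "V 0 = 0" by (simp add: V_def floor_series_below_floor)
  \<comment> \<open>This also proves that both factors are nonzero, which justifies the divisions in
    the first and last identities.\<close>
  then have K00: "K * ?F 0 0 0 = 1" using K[of 0] by simp
  then have nz: "?F 0 0 0 \<noteq> 0" and "K \<noteq> 0" by auto
  with K00 have F00: "?F 0 0 0 = 1 / K" by (simp add: field_simps)
  have F0: "?F 0 0 j = ?F 0 0 0 * V j" if "j \<ge> 1" for j
  proof -
    have "?F 0 0 j = ?F 0 0 0 * (K * ?F 0 0 j)"
      using K00 by (simp add: mult.assoc[symmetric] mult.commute[of _ K])
    with K[of j] that show ?thesis by simp
  qed
  have Fi: "?F 0 i 0 = ?F 0 0 0 * U i" if "i \<ge> 1" for i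
    using visit[OF that, of 0] by (simp add: floor_series_below_floor mult.commute)
  \<comment> \<open>A down step to the axis takes its weight index from its final height, an up step
    from the axis from its initial height, so the index is 0 in both cases.\<close>
  have down: "?w j 0 = fls_const (a (- int j) 0)" if "j \<in> {1..p}" for j
    using that by (simp add: height_weight_def step_weight_def)
  have up: "?w 0 i = fls_const (a (int i) 0)" if "i \<in> {1..q}" for i
    using that by (simp add: height_weight_def step_weight_def)
  have A1: "A1_series p q a (i - 1) (j - 1) = ?F 1 i j" if "i \<ge> 1" "j \<ge> 1" for i j
    using that by (simp add: A1_series_eq_floor_series)
  have U: "U i = (\<Sum>j=1..p. fls_const (a (- int j) 0) * A1_series p q a (i - 1) (j - 1))"
    if "i \<ge> 1" for i
    unfolding U_def using that by (intro sum.cong) (simp_all add: down A1[unfolded One_nat_def])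
  have V: "V j = (\<Sum>i=1..q. fls_const (a (int i) 0) * A1_series p q a (i - 1) (j - 1))"
    if "j \<ge> 1" for j
    unfolding V_def using that by (intro sum.cong) (simp_all add: up A1[unfolded One_nat_def])
  have "(\<Sum>i=1..q. ?w 0 i * U i) = (\<Sum>i=1..q. \<Sum>j=1..p.
      fls_const (a (int i) 0) * fls_const (a (- int j) 0) * A1_series p q a (i - 1) (j - 1))"
    by (intro sum.cong) (simp_all only: up U sum_distrib_left mult.assoc atLeastAtMost_iff)
  then have K_eq: "K = zvar - fls_const (a 0 0) - (\<Sum>i=1..q. \<Sum>j=1..p.
      fls_const (a (int i) 0) * fls_const (a (- int j) 0) * A1_series p q a (i - 1) (j - 1))"
    by (simp only: K_def)
  show ?thesis
  proof (intro conjI allI impI)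
    fix i j :: nat assume ij: "i \<ge> 1" "j \<ge> 1"
    show "A_series p q a i j = A_series p q a i 0 * A_series p q a 0 j / A_series p q a 0 0
        + A1_series p q a (i - 1) (j - 1)"
      \<comment> \<open>By \<open>Fi\<close> the quotient reduces to \<open>U i * ?F 0 0 j\<close>,
        the second term of \<open>visit\<close>.\<close>
      using nz by (simp only: A_series_eq_floor_series A1 Fi visit[of i j] ij) simp
  qed (simp_all only: A_series_eq_floor_series F00 K_eq F0 Fi U V)
qed

end
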